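(* Consider the feasible set $\mathcal F$ of all $(z,x,y,w,\pi,\mu,\theta)$ satisfying $$\begin{aligned} &(z,x)\in\mathcal P,\quad 0\le z\le\overline z,\quad 0\le x\le\overline x,\quad \pi\ge0,\\ &Gy+Hw-\begin{pmatrix} x \\ 0 \end{pmatrix}=h,\quad 0\le y\le\overline y,\quad 0\le w\le\overline w,\quad \mu\ge0,\quad \theta\ge0,\\ &\Phi(y)+G^\top\pi+\theta^y-\mu^y=0,\quad H^\top\pi+\theta^w-\mu^w=0,\\ &y^\top\mu^y=0,\quad(\overline y-y)^\top\theta^y=0,\quad w^\top\mu^w=0,\quad(\overline w-w)^\top\theta^w=0. \end{aligned}$$ Then the problem $$\vartheta_{\mathrm{dual}}=\max_{(z,x,y,w,\pi,\mu,\theta)\in\mathcal F}\ -\langle\Phi(y),y\rangle-\overline w^\top\theta^w-\overline y^\top\theta^y-h^\top\pi-c_x^\top x-c_z^\top z$$ is a reformulation of the problem $$\vartheta_{\mathrm{KKT}}=\max_{(z,x,y,w,\pi,\mu,\theta)\in\mathcal F}\ \pi_0^\top x-c_x^\top x-c_z^\top z,$$ i.e. the two problems have the same optimal value and the same optimal solutions.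
   Context: Leader. $\overline{\mathcal P}\subseteq\mathbb R^{d_z+d_x}$ is a closed convex set, $\mathcal Z=\mathbb Z^{d_z^I}\times\mathbb R^{d_z-d_z^I}$, $\mathcal X=\mathbb Z^{d_x^I}\times\mathbb R^{d_x-d_x^I}$, and $\mathcal P=\overline{\mathcal P}\cap(\mathcal Z\times\mathcal X)$. The bounds $\overline z,\overline x$ are finite; $c_z,c_x$ are given cost vectors. Follower. For a leader decision $x$, the follower feasible set $\mathcal Y(x)$ is the set of $(y,w)\in\mathbb R^{d_y+d_w}$ with $G_0y+H_0w-x=h_0$, $G_1y+H_1w=h_1$, $0\le y\le\overline y$, $0\le w\le\overline w$, where components of $\overline y,\overline w$ may be $+\infty$. Write $G=\begin{pmatrix} G_0 \\ G_1 \end{pmatrix}$, $H=\begin{pmatrix} H_0 \\ H_1 \end{pmatrix}$, $h=\begin{pmatrix} h_0 \\ h_1 \end{pmatrix}$. The vectors $\pi=(\pi_0,\pi_1)$, $\mu=(\mu^y,\mu^w)$, $\theta=(\theta^y,\theta^w)$ are dual variables of the equalities, of $y,w\ge0$, and of $y\le\overline y$, $w\le\overline w$, respectively. If an upper bound is $+\infty$, the corresponding component of $\theta$ equals $0$ and its product with the bound (and with the slack) is $0$. Standing assumptions. (1) $\Phi:\mathrm{dom}(\Phi)\subseteq\mathbb R^{d_y}\to\mathbb R^{d_y}$ is continuously differentiable with symmetric Jacobian (with $y\in\mathrm{dom}(\Phi)$ implicitly required). (2) $\Phi$ is strictly monotone: $\langle\Phi(y^1)-\Phi(y^2),y^1-y^2\rangle>0$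 for all $y^1\neq y^2$ in $\mathrm{dom}(\Phi)$. (3) For every feasible leader decision $x$ there is $(y^*,w^* )\in\mathcal Y(x)$ with $\langle\Phi(y^* ),y'-y^*\rangle\ge0$ for all $y'\in\mathrm{proj}_y\mathcal Y(x)$. Optimal values are understood as suprema in $[-\infty,+\infty]$. *)

theory Defs
  imports "HOL-Analysis.Analysis"
begin

text \<open>
  Block vectors such as \<open>h = (h\<^sub>0, h\<^sub>1)\<close> are indexed by a sum type. Since a matrix is a vector
  of rows, \<open>vstack\<close> also stacks matrices on top of each other.
\<close>

definition vstack :: "'a ^ 'm::finite \<Rightarrow> 'a ^ 'n::finite \<Rightarrow> 'a ^ ('m + 'n)"
  where "vstack a b = (\<chi> k. case k of Inl i \<Rightarrow> a $ i | Inr j \<Rightarrow> b $ j)"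

definition vfst :: "'a ^ ('m::finite + 'n::finite) \<Rightarrow> 'a ^ 'm"
  where "vfst v = (\<chi> i. v $ Inl i)"

text \<open>
  Vectors of upper bounds have entries in \<open>ereal\<close>, where \<open>\<infinity> * 0 = 0\<close>. Hence the products below
  obey the convention that an infinite bound (or slack) times a zero multiplier is zero.
\<close>

definition below :: "real ^ 'n \<Rightarrow> ereal ^ 'n \<Rightarrow> bool"
  where "below v u \<longleftrightarrow> (\<forall>i. ereal (v $ i) \<le> u $ i)"

definition bound_prod :: "ereal ^ 'n \<Rightarrow> real ^ 'n \<Rightarrow> ereal"
  where "bound_prod u t = (\<Sum>i\<in>UNIV. u $ i * ereal (t $ i))"

definition slack :: "ereal ^ 'n \<Rightarrow> real ^ 'n \<Rightarrow> ereal ^ 'n"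
  where "slack u v = (\<chi> i. u $ i - ereal (v $ i))"

definition zero_at_infinite :: "ereal ^ 'n \<Rightarrow> real ^ 'n \<Rightarrow> bool"
  where "zero_at_infinite u t \<longleftrightarrow> (\<forall>i. u $ i = \<infinity> \<longrightarrow> t $ i = 0)"

text \<open>
  \<open>int_z\<close> and \<open>int_x\<close> are the sets of indices of the integer components of \<open>z\<close> and \<open>x\<close>.
  The function \<open>Phi\<close> is only meaningful on its domain \<open>dom_Phi\<close>.
\<close>

record ('z::finite, 'x::finite, 'y::finite, 'w::finite, 'm::finite) bilevel =
  Pbar :: "((real ^ 'z) \<times> (real ^ 'x)) set"
  int_z :: "'z set"
  int_x :: "'x set"
  zbar :: "real ^ 'z"
  xbar :: "real ^ 'x"
  cost_z :: "real ^ 'z"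
  cost_x :: "real ^ 'x"
  G0 :: "real ^ 'y ^ 'x"
  G1 :: "real ^ 'y ^ 'm"
  H0 :: "real ^ 'w ^ 'x"
  H1 :: "real ^ 'w ^ 'm"
  h0 :: "real ^ 'x"
  h1 :: "real ^ 'm"
  ybar :: "ereal ^ 'y"
  wbar :: "ereal ^ 'w"
  dom_Phi :: "(real ^ 'y) set"
  Phi :: "real ^ 'y \<Rightarrow> real ^ 'y"

definition mat_G where "mat_G B = vstack (G0 B) (G1 B)"
definition mat_H where "mat_H B = vstack (H0 B) (H1 B)"
definition rhs_h where "rhs_h B = vstack (h0 B) (h1 B)"

definition leader_P where
  "leader_P B = Pbar B \<inter>
     ({z. \<forall>i\<in>int_z B. z $ i \<in> \<int>} \<times> {x. \<forall>i\<in>int_x B. x $ i \<in> \<int>})"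

definition leader_feasible where
  "leader_feasible B z x \<longleftrightarrow>
     (z, x) \<in> leader_P B \<and> 0 \<le> z \<and> z \<le> zbar B \<and> 0 \<le> x \<and> x \<le> xbar B"

definition follower_feasible where
  "follower_feasible B x = {(y, w).
     y \<in> dom_Phi B \<and>
     G0 B *v y + H0 B *v w - x = h0 B \<and>
     G1 B *v y + H1 B *v w = h1 B \<and>
     0 \<le> y \<and> below y (ybar B) \<and> 0 \<le> w \<and> below w (wbar B)}"

text \<open>
  The domain need not be open, so derivatives are taken within it; on an open domain this is
  ordinary continuous differentiability.
\<close>

definition C1_symmetric_on :: "(real ^ 'n \<Rightarrow> real ^ 'n) \<Rightarrow> (real ^ 'n) set \<Rightarrow> bool"
  where "C1_symmetric_on f D \<longleftrightarrow>
     (\<exists>J :: real ^ 'n \<Rightarrow> real ^ 'n ^ 'n.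
        (\<forall>y\<in>D. (f has_derivative (\<lambda>v. J y *v v)) (at y within D)) \<and>
        continuous_on D J \<and>
        (\<forall>y\<in>D. transpose (J y) = J y))"

definition strictly_monotone_on :: "('a::real_inner) set \<Rightarrow> ('a \<Rightarrow> 'a) \<Rightarrow> bool"
  where "strictly_monotone_on D f \<longleftrightarrow>
     (\<forall>y1\<in>D. \<forall>y2\<in>D. y1 \<noteq> y2 \<longrightarrow> (f y1 - f y2) \<bullet> (y1 - y2) > 0)"

definition bilevel_setting where
  "bilevel_setting B \<longleftrightarrow>
     closed (Pbar B) \<and> convex (Pbar B) \<and>
     (\<forall>i. ybar B $ i \<noteq> -\<infinity>) \<and> (\<forall>i. wbar B $ i \<noteq> -\<infinity>) \<and>
     C1_symmetric_on (Phi B) (dom_Phi B) \<and>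
     strictly_monotone_on (dom_Phi B) (Phi B) \<and>
     (\<forall>z x. leader_feasible B z x \<longrightarrow>
        (\<exists>(y, w) \<in> follower_feasible B x.
           \<forall>y' \<in> fst ` follower_feasible B x. Phi B y \<bullet> (y' - y) \<ge> 0))"

text \<open>
  Points are tuples \<open>(z, x, y, w, \<pi>, (\<mu>\<^sup>y, \<mu>\<^sup>w), (\<theta>\<^sup>y, \<theta>\<^sup>w))\<close> with \<open>\<pi> = (\<pi>\<^sub>0, \<pi>\<^sub>1)\<close> a block vector.
\<close>

type_synonym ('z, 'x, 'y, 'w, 'm) point =
  "(real ^ 'z) \<times> (real ^ 'x) \<times> (real ^ 'y) \<times> (real ^ 'w) \<times> (real ^ ('x + 'm)) \<times>
   ((real ^ 'y) \<times> (real ^ 'w)) \<times> ((real ^ 'y) \<times> (real ^ 'w))"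

definition KKT_feasible ::
  "('z::finite, 'x::finite, 'y::finite, 'w::finite, 'm::finite) bilevel \<Rightarrow>
   ('z, 'x, 'y, 'w, 'm) point set" where
  "KKT_feasible B = {(z, x, y, w, \<pi>, (\<mu>y, \<mu>w), (\<theta>y, \<theta>w)).
     (z, x) \<in> leader_P B \<and> 0 \<le> z \<and> z \<le> zbar B \<and> 0 \<le> x \<and> x \<le> xbar B \<and> 0 \<le> \<pi> \<and>
     y \<in> dom_Phi B \<and>
     mat_G B *v y + mat_H B *v w - vstack x 0 = rhs_h B \<and>
     0 \<le> y \<and> below y (ybar B) \<and> 0 \<le> w \<and> below w (wbar B) \<and>
     0 \<le> \<mu>y \<and> 0 \<le> \<mu>w \<and> 0 \<le> \<theta>y \<and> 0 \<le> \<theta>w \<and>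
     zero_at_infinite (ybar B) \<theta>y \<and> zero_at_infinite (wbar B) \<theta>w \<and>
     Phi B y + transpose (mat_G B) *v \<pi> + \<theta>y - \<mu>y = 0 \<and>
     transpose (mat_H B) *v \<pi> + \<theta>w - \<mu>w = 0 \<and>
     y \<bullet> \<mu>y = 0 \<and> bound_prod (slack (ybar B) y) \<theta>y = 0 \<and>
     w \<bullet> \<mu>w = 0 \<and> bound_prod (slack (wbar B) w) \<theta>w = 0}"

definition dual_objective ::
  "('z::finite, 'x::finite, 'y::finite, 'w::finite, 'm::finite) bilevel \<Rightarrow>
   ('z, 'x, 'y, 'w, 'm) point \<Rightarrow> ereal" where
  "dual_objective B = (\<lambda>(z, x, y, w, \<pi>, (\<mu>y, \<mu>w), (\<theta>y, \<theta>w)).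
     - ereal (Phi B y \<bullet> y) - bound_prod (wbar B) \<theta>w - bound_prod (ybar B) \<theta>y
     - ereal (rhs_h B \<bullet> \<pi>) - ereal (cost_x B \<bullet> x) - ereal (cost_z B \<bullet> z))"

definition KKT_objective ::
  "('z::finite, 'x::finite, 'y::finite, 'w::finite, 'm::finite) bilevel \<Rightarrow>
   ('z, 'x, 'y, 'w, 'm) point \<Rightarrow> ereal" where
  "KKT_objective B = (\<lambda>(z, x, y, w, \<pi>, (\<mu>y, \<mu>w), (\<theta>y, \<theta>w)).
     ereal (vfst \<pi> \<bullet> x - cost_x B \<bullet> x - cost_z B \<bullet> z))"

definition optimal_value :: "'a set \<Rightarrow> ('a \<Rightarrow> ereal) \<Rightarrow> ereal"
  where "optimal_value F f = (SUP p\<in>F. f p)"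

definition optimal_solutions :: "'a set \<Rightarrow> ('a \<Rightarrow> ereal) \<Rightarrow> 'a set"
  where "optimal_solutions F f = {p \<in> F. \<forall>q\<in>F. f q \<le> f p}"

end

theory Submission
  imports Defs
begin

text \<open>
  The two objectives agree at every feasible point, so the two problems are the same problem.
  At a feasible point, pair the stationarity conditions with \<open>y\<close> and \<open>w\<close> and add them. The terms
  with \<open>\<mu>\<close> vanish by complementarity, and since \<open>G y + H w = h + (x, 0)\<close> this leaves
  \[ \langle \Phi(y), y \rangle + h^\top \pi + \pi_0^\top x + y^\top \theta^y + w^\top \theta^w = 0. \]
  Complementarity of \<open>\<theta>\<close> replaces \<open>y\<^sup>T \<theta>\<^sup>y\<close> and \<open>w\<^sup>T \<theta>\<^sup>w\<close> by the products of \<open>\<theta>\<close> with the upper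
  bounds, and the bilinear term \<open>\<pi>\<^sub>0\<^sup>T x\<close> becomes the linear expression in the dual objective.
  This is strong duality for the follower's variational inequality. Infinite bounds need
  the care that \<open>complementary_bound_prod\<close> takes: there the multiplier is zero, so all quantities
  remain finite.
\<close>

lemma inner_vstack_zero:
  fixes x :: "real ^ 'x::finite" and \<pi> :: "real ^ ('x + 'm::finite)"
  shows "\<pi> \<bullet> vstack x 0 = vfst \<pi> \<bullet> x"
proof -
  have "\<pi> \<bullet> vstack x 0 = (\<Sum>k\<in>UNIV <+> UNIV. \<pi> $ k * vstack x 0 $ k)"
    by (simp add: inner_vec_def)
  also have "\<dots> = vfst \<pi> \<bullet> x"
    by (subst sum.Plus) (simp_all add: inner_vec_def vstack_def vfst_def)
  finally show ?thesis .
qed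

lemma inner_transpose_mult:
  fixes A :: "real ^ 'n::finite ^ 'm::finite"
  shows "(transpose A *v p) \<bullet> v = p \<bullet> (A *v v)"
  by (simp add: dot_lmul_matrix)

text \<open>
  In \<open>ereal\<close> a vanishing sum of products cannot simply be rearranged, as the bound may be infinite.
  An infinite bound has multiplier zero, so every product equals a real one in which the bound is
  replaced by its real part, and the rearrangement takes place in the reals.
\<close>

lemma complementary_bound_prod:
  fixes u :: "ereal ^ 'n::finite" and v t :: "real ^ 'n"
  assumes "below v u" and "zero_at_infinite u t" and "bound_prod (slack u v) t = 0"
  shows "bound_prod u t = ereal (v \<bullet> t)"
proof -
  define r where "r i = real_of_ereal (u $ i)" for i
  have term_bound: "u $ i * ereal (t $ i) = ereal (r i * t $ i)"
    and term_slack: "(u $ i - ereal (v $ i)) * ereal (t $ i) = ereal (r i * t $ i - v $ i * t $ i)"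
    for i
  proof -
    have "ereal (v $ i) \<le> u $ i" and "u $ i = \<infinity> \<Longrightarrow> t $ i = 0"
      using assms by (auto simp: below_def zero_at_infinite_def)
    then show "u $ i * ereal (t $ i) = ereal (r i * t $ i)"
      and "(u $ i - ereal (v $ i)) * ereal (t $ i) = ereal (r i * t $ i - v $ i * t $ i)"
      by (cases "u $ i"; simp add: r_def algebra_simps flip: zero_ereal_def)+
  qed
  have "(\<Sum>i\<in>UNIV. r i * t $ i - v $ i * t $ i) = 0"
    using assms(3) by (simp add: bound_prod_def slack_def term_slack)
  then show ?thesis
    by (simp add: bound_prod_def term_bound inner_vec_def sum_subtractf)
qed

lemma objectives_agree:
  assumes "p \<in> KKT_feasible B"
  shows "dual_objective B p = KKT_objective B p"
proof -
  obtain z x y w \<pi> \<mu>y \<mu>w \<theta>y \<theta>w where p: "p = (z, x, y, w, \<pi>, (\<mu>y, \<mu>w), (\<theta>y, \<theta>w))"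
    by (metis prod.exhaust)
  have primal: "mat_G B *v y + mat_H B *v w - vstack x 0 = rhs_h B"
    and stat_y: "Phi B y + transpose (mat_G B) *v \<pi> + \<theta>y - \<mu>y = 0"
    and stat_w: "transpose (mat_H B) *v \<pi> + \<theta>w - \<mu>w = 0"
    and compl: "y \<bullet> \<mu>y = 0" "w \<bullet> \<mu>w = 0"
    and bounds: "bound_prod (ybar B) \<theta>y = ereal (y \<bullet> \<theta>y)" "bound_prod (wbar B) \<theta>w = ereal (w \<bullet> \<theta>w)"
    using assms by (auto simp: p KKT_feasible_def intro!: complementary_bound_prod)
  have "(Phi B y + transpose (mat_G B) *v \<pi> + \<theta>y - \<mu>y) \<bullet> y = 0"
    by (simp only: stat_y inner_zero_left)
  then have "Phi B y \<bullet> y + \<pi> \<bullet> (mat_G B *v y) + y \<bullet> \<theta>y = 0"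
    using compl
    unfolding inner_add_left inner_diff_left inner_transpose_mult by (simp add: inner_commute)
  moreover have "(transpose (mat_H B) *v \<pi> + \<theta>w - \<mu>w) \<bullet> w = 0"
    by (simp only: stat_w inner_zero_left)
  then have "\<pi> \<bullet> (mat_H B *v w) + w \<bullet> \<theta>w = 0"
    using compl
    unfolding inner_add_left inner_diff_left inner_transpose_mult by (simp add: inner_commute)
  moreover have "rhs_h B \<bullet> \<pi> = \<pi> \<bullet> (mat_G B *v y) + \<pi> \<bullet> (mat_H B *v w) - vfst \<pi> \<bullet> x"
    unfolding primal[symmetric] inner_add_left inner_diff_left
    using inner_vstack_zero[of \<pi> x] by (simp add: inner_commute)
  ultimately show ?thesis
    by (simp add: p dual_objective_def KKT_objective_def bounds)
qed

theorem theorem1: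
  fixes B :: "('z::finite, 'x::finite, 'y::finite, 'w::finite, 'm::finite) bilevel"
  assumes "bilevel_setting B"
  shows "optimal_value (KKT_feasible B) (dual_objective B)
           = optimal_value (KKT_feasible B) (KKT_objective B) \<and>
         optimal_solutions (KKT_feasible B) (dual_objective B)
           = optimal_solutions (KKT_feasible B) (KKT_objective B)"
  by (auto simp: optimal_value_def optimal_solutions_def objectives_agree)

end
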